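(* Let $\theta$ be a vector of split positions and suppose that: (A1) (ball constraints) each of the sets $[T_k,T_{k+1}]\times X_i\times U$, $X_i$, $X_T\cap X_i$, and $[T_k,T_{k+1}]\times(X_a\cap X_b)\times U$ has, in its polynomial description used in the relaxation, a ball constraint $g_{\rm B}(\cdot)=R_{\rm B}^2-\|\cdot\|^2$ such that the set is contained in $\{g_{\rm B}\ge0\}$; (A2) $h_{a,b}^\top f(t,x,u)\ne 0$ for all $t\in[0,T]$, $x\in X_a\cap X_b$, $u\in U$ and all $(a,b)\in N_X$; (A3) the primal-dual solution $(x,y,s)$ of the conic pair (SDP) given in the context is unique and strictly complementary for the problem data $\mathcal{D}(\theta)=(A(\theta),b(\theta),c(\theta))$. Then the mapping from the split positions to the infimum of the sum-of-squares relaxation (SOS) is differentiable at the point $\theta$.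
   Context: Setting. $\mathbb{Z}_n=\{1,\dots,n\}$. Consider the control system $\dot x(t)=f(t,x(t),u(t))$, $t\in[0,T]$, $T>0$, $x(t)\in\mathbb{R}^n$, $u(t)\in\mathbb{R}^m$, with $f$ a polynomial vector field, and the basic semialgebraic sets (each defined by finitely many polynomial inequalities $g_j\ge 0$) $U\subset\mathbb{R}^m$ (inputs), $X\subset\mathbb{R}^n$ (states), $X_T\subset\mathbb{R}^n$ (target set). Splitting. $[0,T]=\bigcup_{k=1}^{K-1}[T_k,T_{k+1}]$ with $T_1=0$, $T_K=T$, $K\ge 2$. $X=\bigcup_{i=1}^I X_i$, where the closed sets $X_i$ are axis-aligned boxes with disjoint interiors, obtained by cutting $X$ with axis-orthogonal hyperplanes. The vector $\theta$ of split positions consists of the interior time splits $T_2,\dots,T_{K-1}$ and the positions of the splitting hyperplanes along the coordinate axes; the number of splits and cells is fixed. $N_X$ is the set of pairs $(a,b)$ of neighbouring cells (cells with a common boundary $X_a\cap X_b\ne\emptyset$ lying in a splitting hyperplane), and $h_{a,b}$ is the unit normal of $X_a\cap X_b$ oriented in the positive coordinate direction; pairs are ordered so that $h_{a,b}$ points from $X_a$ to $X_b$. $\mathcal{L}v=\frac{\partial v}{\partial t}+\nabla_x v\cdot f$. Relaxation (SOS) of a given order $d$. Let $z=(t,x,u)$. Let $\boldsymbol{g}^X_i(x)$, $\boldsymbol{g}^{X_T}_i(x)$, $\boldsymbol{g}^U(u)$, $\boldsymbol{g}^\tau_k(t)$ be the column vectors of polynomials describing $X_i$, $X_T\cap X_i$,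 $U$, $[T_k,T_{k+1}]$, and $\boldsymbol{g}_{k,a,b}(z)$ that describing $[T_k,T_{k+1}]\times(X_a\cap X_b)\times U$. The problem is to minimize $\sum_i\mathbf{w}_i^\top l_i$, where $\mathbf{w}_i$ is the coefficient vector of $w_i$ and $l_i$ the vector of moments of Lebesgue measure on $X_i$ in the same basis, over polynomials $w_i(x),v_{i,k}(t,x)$ and sum-of-squares polynomials $q$, $s$ (all $q$'s, all $s$'s and all entries of vectors $\boldsymbol{s}$ below), subject to the polynomial identities, for all $i\in\mathbb{Z}_I$, $k\in\mathbb{Z}_{K-1}$, $(a,b)\in N_X$: - $-(\mathcal{L}v_{i,k})(z)=q_{i,k}(z)+\boldsymbol{s}^\tau_{i,k}(z)^\top\boldsymbol{g}^\tau_k(t)+\boldsymbol{s}^X_{i,k}(z)^\top\boldsymbol{g}^X_i(x)+\boldsymbol{s}^U_{i,k}(z)^\top\boldsymbol{g}^U(u)$; - $w_i(x)-v_{i,1}(0,x)-1=q^0_i(x)+\boldsymbol{s}^0_i(x)^\top\boldsymbol{g}^X_i(x)$; - $v_{i,K-1}(T,x)=q^T_i(x)+\boldsymbol{s}^{X_T}_i(x)^\top\boldsymbol{g}^{X_T}_i(x)$; - $w_i(x)=q^w_i(x)+\boldsymbol{s}^w_i(x)^\top\boldsymbol{g}^X_i(x)$; - $v_{i,k}(T_{k+1},x)-v_{i,k+1}(T_{k+1},x)=q^\tau_{i,k}(x)+\boldsymbol{s}^t_{i,k}(x)^\top\boldsymbol{g}^X_i(x)$ (for $k\le K-2$); - $v_{a,k}(t,x)-v_{b,k}(t,x)=q^1_{k,a,b}(z)+s^1_{k,a,b}(z)\,h_{a,b}^\top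 f(t,x,u)+\boldsymbol{s}^{\rm a_1}_{k,a,b}(z)^\top\boldsymbol{g}_{k,a,b}(z)$ and $v_{b,k}(t,x)-v_{a,k}(t,x)=q^2_{k,a,b}(z)-s^2_{k,a,b}(z)\,h_{a,b}^\top f(t,x,u)+\boldsymbol{s}^{\rm a_2}_{k,a,b}(z)^\top\boldsymbol{g}_{k,a,b}(z)$, both with $x$ restricted to the splitting hyperplane containing $X_a\cap X_b$ (the split coordinate is replaced by the split position). The degrees of all polynomial decision variables are chosen so that the degrees of all polynomials appearing in these identities do not exceed $d$. Conic form (SDP). For each $\theta$, (SOS) is written as a semidefinite program in primal-dual conic form (here $x,y,s$ denote decision vectors of the SDP): $$p^\star(\theta)=\min\, c(\theta)^\top x\ \text{ s.t. } A(\theta)x+s=b(\theta),\ s\in\mathcal{K};\qquad d^\star(\theta)=\min\, b(\theta)^\top y\ \text{ s.t. } A(\theta)^\top y+c(\theta)=0,\ y\in\mathcal{K}^\star,$$ where $\mathcal{K}$ is a product of zero/free cones and (vectorized) positive semidefinite cones, $\mathcal{K}^\star$ is its dual cone, and the dimensions and $\mathcal{K}$ do not depend on $\theta$; strong duality reads $p^\star=-d^\star$. The data $\mathcal{D}(\theta)=(A(\theta),b(\theta),c(\theta))$ depend differentiably on $\theta$. The mapping in question is $\theta\mapsto p^\star(\theta)=\mathcal{S}(\mathcal{D}(\theta))$. A primal-dual solution $(x,y,s)$ satisfies $Ax+s=b$, $A^\top y+c=0$, $s^\top y=0$, $s\in\mathcal{K}$, $y\in\mathcal{K}^\star$; it is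 strictly complementary if the matrices $Y$ and $S$ formed from the semidefinite parts of $y$ and $s$ satisfy that $\operatorname{rank}Y+\operatorname{rank}S$ is full (equal to the matrix size, blockwise). *)

theory Defs
  imports "HOL-Analysis.Analysis"
begin

section \<open>Polynomials of bounded degree and truncated quadratic modules\<close>

text \<open>Real polynomials are represented by polynomial functions on a Euclidean space, so polynomial
  identities are identities of functions. A monomial is an exponent vector indexed by the standard
  basis.\<close>

definition monoms :: "nat \<Rightarrow> ('a::euclidean_space \<Rightarrow> nat) set" where
  "monoms d = {\<alpha>. (\<forall>b. b \<notin> Basis \<longrightarrow> \<alpha> b = 0) \<and> (\<Sum>b\<in>Basis. \<alpha> b) \<le> d}"

definition monomial :: "('a::euclidean_space \<Rightarrow> nat) \<Rightarrow> 'a \<Rightarrow> real" where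
  "monomial \<alpha> z = (\<Prod>b\<in>Basis. (z \<bullet> b) ^ \<alpha> b)"

definition pval :: "nat \<Rightarrow> (('a::euclidean_space \<Rightarrow> nat) \<Rightarrow> real) \<Rightarrow> 'a \<Rightarrow> real" where
  "pval d c z = (\<Sum>\<alpha>\<in>monoms d. c \<alpha> * monomial \<alpha> z)"

definition polys :: "nat \<Rightarrow> ('a::euclidean_space \<Rightarrow> real) set" where
  "polys d = range (pval d)"

definition sos :: "('a::euclidean_space \<Rightarrow> real) \<Rightarrow> bool" where
  "sos p \<longleftrightarrow> (\<exists>(N::nat) r. (\<forall>i<N. real_polynomial_function (r i)) \<and> p = (\<lambda>z. \<Sum>i<N. (r i z)\<^sup>2))"

text \<open>The functions \<open>q + s\<^sup>T g\<close> with sum-of-squares \<open>q\<close>, \<open>s\<close> such that all terms have degree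
  at most \<open>d\<close>.\<close>

definition qmodule :: "nat \<Rightarrow> ('a::euclidean_space \<Rightarrow> real) list \<Rightarrow> ('a \<Rightarrow> real) set" where
  "qmodule d gs = {p. \<exists>q ss. sos q \<and> q \<in> polys d \<and> length ss = length gs \<and>
     (\<forall>j<length gs. sos (ss ! j) \<and> (\<lambda>z. (ss ! j) z * (gs ! j) z) \<in> polys d) \<and>
     p = (\<lambda>z. q z + (\<Sum>j<length gs. (ss ! j) z * (gs ! j) z))}"

definition basic_set :: "('a \<Rightarrow> real) list \<Rightarrow> 'a set" where
  "basic_set gs = {x. \<forall>g\<in>set gs. 0 \<le> g x}"

definition grad :: "((real^'n) \<Rightarrow> real) \<Rightarrow> (real^'n) \<Rightarrow> (real^'n)" where
  "grad g x = (\<chi> j. frechet_derivative g (at x) (axis j 1))"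

definition lie :: "(real \<times> (real^'n) \<times> (real^'m) \<Rightarrow> (real^'n)) \<Rightarrow> (real \<times> (real^'n) \<Rightarrow> real)
    \<Rightarrow> real \<times> (real^'n) \<times> (real^'m) \<Rightarrow> real" where
  "lie f v = (\<lambda>(t, x, u). deriv (\<lambda>\<tau>. v (\<tau>, x)) t + grad (\<lambda>y. v (t, y)) x \<bullet> f (t, x, u))"


section \<open>Split control problems\<close>

text \<open>\<open>Time_split k\<close> names the time split \<open>T\<^sub>k\<close>; \<open>Space_split j l\<close> names the \<open>l\<close>-th hyperplane
  orthogonal to the \<open>j\<close>-th axis, counted from 1 in increasing order of position.\<close>

datatype 'n split_id = Time_split nat | Space_split 'n nat

text \<open>A cell is given by its position in the grid: on axis \<open>j\<close> it lies between the grid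
  positions \<open>c j\<close> and \<open>c j + 1\<close>.\<close>

type_synonym 'n cell_id = "'n \<Rightarrow> nat"

text \<open>The state set \<open>X\<close> is the box from \<open>lower\<close> to \<open>upper\<close>. The vector of split positions is an
  element of \<open>real^'p\<close>, and \<open>slot\<close> tells in which component a split position is stored. The fields
  \<open>time_desc\<close>, \<open>cell_desc\<close>, \<open>target_desc\<close>, \<open>iface_desc\<close> are the polynomial descriptions used in
  the relaxation of \<open>[T\<^sub>k, T\<^sub>k\<^sub>+\<^sub>1]\<close>, \<open>X\<^sub>i\<close>, \<open>X\<^sub>T \<inter> X\<^sub>i\<close> and \<open>[T\<^sub>k, T\<^sub>k\<^sub>+\<^sub>1] \<times> (X\<^sub>a \<inter> X\<^sub>b) \<times> U\<close>.\<close>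

record ('n::finite, 'm::finite, 'p::finite) split_problem =
  horizon :: real
  vfield :: "real \<times> (real^'n) \<times> (real^'m) \<Rightarrow> (real^'n)"
  lower :: "(real^'n)"
  upper :: "(real^'n)"
  input_desc :: "((real^'m) \<Rightarrow> real) list"
  final_desc :: "((real^'n) \<Rightarrow> real) list"
  nT :: nat
  ncuts :: "'n \<Rightarrow> nat"
  slot :: "'n split_id \<Rightarrow> 'p"
  time_desc :: "(real^'p) \<Rightarrow> nat \<Rightarrow> (real \<Rightarrow> real) list"
  cell_desc :: "(real^'p) \<Rightarrow> 'n cell_id \<Rightarrow> ((real^'n) \<Rightarrow> real) list"
  target_desc :: "(real^'p) \<Rightarrow> 'n cell_id \<Rightarrow> ((real^'n) \<Rightarrow> real) list"
  iface_desc :: "(real^'p) \<Rightarrow> nat \<Rightarrow> 'n cell_id \<Rightarrow> 'n cell_id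
      \<Rightarrow> (real \<times> (real^'n) \<times> (real^'m) \<Rightarrow> real) list"
  relax_order :: nat
  degw :: nat
  degv :: nat

definition input_set :: "('n::finite, 'm::finite, 'p::finite) split_problem \<Rightarrow> (real^'m) set" where
  "input_set P = basic_set (input_desc P)"

definition target_set :: "('n::finite, 'm::finite, 'p::finite) split_problem \<Rightarrow> (real^'n) set" where
  "target_set P = basic_set (final_desc P)"

definition split_ids :: "('n::finite, 'm::finite, 'p::finite) split_problem \<Rightarrow> 'n split_id set" where
  "split_ids P = {Time_split k |k. 2 \<le> k \<and> k \<le> nT P - 1}
     \<union> {Space_split j l |j l. 1 \<le> l \<and> l \<le> ncuts P j}"

definition time_pt :: "('n::finite, 'm::finite, 'p::finite) split_problem \<Rightarrow> (real^'p) \<Rightarrow> nat \<Rightarrow> real" where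
  "time_pt P \<theta> k = (if k \<le> 1 then 0 else if nT P \<le> k then horizon P else \<theta> $ slot P (Time_split k))"

definition grid_pt :: "('n::finite, 'm::finite, 'p::finite) split_problem
    \<Rightarrow> (real^'p) \<Rightarrow> 'n \<Rightarrow> nat \<Rightarrow> real" where
  "grid_pt P \<theta> j l = (if l = 0 then lower P $ j else if ncuts P j < l then upper P $ j
     else \<theta> $ slot P (Space_split j l))"

text \<open>The configurations with nondegenerate time intervals and cells.\<close>

definition admissible :: "('n::finite, 'm::finite, 'p::finite) split_problem \<Rightarrow> (real^'p) set" where
  "admissible P = {\<theta>. (\<forall>k\<in>{1..nT P - 1}. time_pt P \<theta> k < time_pt P \<theta> (Suc k)) \<and>
     (\<forall>j. \<forall>l\<le>ncuts P j. grid_pt P \<theta> j l < grid_pt P \<theta> j (Suc l))}"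

definition time_int :: "('n::finite, 'm::finite, 'p::finite) split_problem
    \<Rightarrow> (real^'p) \<Rightarrow> nat \<Rightarrow> real set" where
  "time_int P \<theta> k = {time_pt P \<theta> k .. time_pt P \<theta> (Suc k)}"

definition cells :: "('n::finite, 'm::finite, 'p::finite) split_problem \<Rightarrow> 'n cell_id set" where
  "cells P = {c. \<forall>j. c j \<le> ncuts P j}"

definition cell :: "('n::finite, 'm::finite, 'p::finite) split_problem
    \<Rightarrow> (real^'p) \<Rightarrow> 'n cell_id \<Rightarrow> (real^'n) set" where
  "cell P \<theta> c = cbox (\<chi> j. grid_pt P \<theta> j (c j)) (\<chi> j. grid_pt P \<theta> j (Suc (c j)))"

text \<open>Neighbours share a facet, which has a well-defined normal; the second cell is the one on the
  positive side.\<close>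

definition neighbours :: "('n::finite, 'm::finite, 'p::finite) split_problem
    \<Rightarrow> ('n cell_id \<times> 'n cell_id) set" where
  "neighbours P = {(a, b). a \<in> cells P \<and> b \<in> cells P \<and> (\<exists>j. b = a(j := Suc (a j)))}"

definition split_axis :: "'n cell_id \<Rightarrow> 'n cell_id \<Rightarrow> 'n" where
  "split_axis a b = (THE j. a j \<noteq> b j)"

definition split_pos :: "('n::finite, 'm::finite, 'p::finite) split_problem
    \<Rightarrow> (real^'p) \<Rightarrow> 'n cell_id \<Rightarrow> 'n cell_id \<Rightarrow> real" where
  "split_pos P \<theta> a b = grid_pt P \<theta> (split_axis a b) (b (split_axis a b))"

definition normal :: "'n::finite cell_id \<Rightarrow> 'n cell_id \<Rightarrow> (real^'n)" where
  "normal a b = axis (split_axis a b) 1"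

lemma neighbours_facet:
  fixes P :: "('n::finite, 'm::finite, 'p::finite) split_problem"
  assumes "\<theta> \<in> admissible P" "(a, b) \<in> neighbours P"
  shows "cell P \<theta> a \<inter> cell P \<theta> b \<noteq> {}"
    and "cell P \<theta> a \<inter> cell P \<theta> b = {x \<in> cell P \<theta> a. x \<bullet> normal a b = split_pos P \<theta> a b}"
    and "cell P \<theta> a \<inter> cell P \<theta> b = {x \<in> cell P \<theta> b. x \<bullet> normal a b = split_pos P \<theta> a b}"
proof -
  obtain j where b: "b = a(j := Suc (a j))" and a: "a \<in> cells P" and b': "b \<in> cells P"
    using assms(2) by (auto simp: neighbours_def)
  have ax: "split_axis a b = j"
    unfolding split_axis_def using b by (intro the_equality) (auto split: if_splits)
  have lt: "grid_pt P \<theta> i (a i) < grid_pt P \<theta> i (Suc (a i))"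
    "grid_pt P \<theta> i (b i) < grid_pt P \<theta> i (Suc (b i))" for i
    using assms(1) a b' by (auto simp: admissible_def cells_def)
  have mem: "x \<in> cell P \<theta> c \<longleftrightarrow> (\<forall>i. grid_pt P \<theta> i (c i) \<le> x $ i \<and> x $ i \<le> grid_pt P \<theta> i (Suc (c i)))"
    for x c by (auto simp: cell_def mem_box_cart)
  have pos: "split_pos P \<theta> a b = grid_pt P \<theta> j (Suc (a j))"
    unfolding split_pos_def ax by (simp add: b)
  have dot: "x \<bullet> normal a b = x $ j" for x :: "real^'n"
    unfolding normal_def ax by (simp add: inner_axis)
  have ltj: "grid_pt P \<theta> j (a j) < grid_pt P \<theta> j (Suc (a j))"
    "grid_pt P \<theta> j (Suc (a j)) < grid_pt P \<theta> j (Suc (Suc (a j)))"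
    using lt[of j] by (simp_all add: b)
  have "(\<chi> i. grid_pt P \<theta> i (b i)) \<in> cell P \<theta> a \<inter> cell P \<theta> b"
    using lt ltj by (auto simp: mem b less_imp_le)
  then show "cell P \<theta> a \<inter> cell P \<theta> b \<noteq> {}" by blast
  have bi: "b i = (if i = j then Suc (a j) else a i)" for i
    by (simp add: b)
  have both: "x \<in> cell P \<theta> a \<and> x \<in> cell P \<theta> b \<longleftrightarrow> x \<in> cell P \<theta> c \<and> x $ j = grid_pt P \<theta> j (Suc (a j))"
    if "c = a \<or> c = b" for x c
    unfolding mem using that ltj
    by (smt (verit) bi)
  show "cell P \<theta> a \<inter> cell P \<theta> b = {x \<in> cell P \<theta> a. x \<bullet> normal a b = split_pos P \<theta> a b}"
    "cell P \<theta> a \<inter> cell P \<theta> b = {x \<in> cell P \<theta> b. x \<bullet> normal a b = split_pos P \<theta> a b}"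
    using both by (auto simp: set_eq_iff dot pos)
qed

text \<open>Substitution of the split position for the split coordinate.\<close>

definition restr :: "('n::finite, 'm::finite, 'p::finite) split_problem
    \<Rightarrow> (real^'p) \<Rightarrow> 'n cell_id \<Rightarrow> 'n cell_id
    \<Rightarrow> real \<times> (real^'n) \<times> (real^'m) \<Rightarrow> real \<times> (real^'n) \<times> (real^'m)" where
  "restr P \<theta> a b = (\<lambda>(t, x, u).
     (t, (\<chi> j. if j = split_axis a b then split_pos P \<theta> a b else x $ j), u))"

text \<open>\<open>iface_desc\<close> is only used on the splitting hyperplane, so it need only describe the facet
  there (the equation of the hyperplane may, but need not, be part of it). The degree \<open>degv\<close> is
  chosen such that no polynomial in the relaxation exceeds the degree \<open>relax_order\<close>. Requiring \<open>slot\<close>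
  to be injective but not surjective also covers the case without any splits.\<close>

definition well_posed :: "('n::finite, 'm::finite, 'p::finite) split_problem \<Rightarrow> bool" where
  "well_posed P \<longleftrightarrow>
     0 < horizon P \<and> 2 \<le> nT P \<and> (\<forall>j. lower P $ j < upper P $ j) \<and>
     polynomial_function (vfield P) \<and>
     (\<forall>g\<in>set (input_desc P). real_polynomial_function g) \<and>
     (\<forall>g\<in>set (final_desc P). real_polynomial_function g) \<and>
     inj_on (slot P) (split_ids P) \<and>
     degw P \<le> relax_order P \<and> degv P \<le> relax_order P \<and>
     (\<forall>v\<in>polys (degv P). lie (vfield P) v \<in> polys (relax_order P)) \<and>
     (\<forall>\<theta>\<in>admissible P.
       (\<forall>k\<in>{1..nT P - 1}. (\<forall>g\<in>set (time_desc P \<theta> k). real_polynomial_function g) \<and>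
          basic_set (time_desc P \<theta> k) = time_int P \<theta> k) \<and>
       (\<forall>i\<in>cells P. (\<forall>g\<in>set (cell_desc P \<theta> i). real_polynomial_function g) \<and>
          basic_set (cell_desc P \<theta> i) = cell P \<theta> i) \<and>
       (\<forall>i\<in>cells P. (\<forall>g\<in>set (target_desc P \<theta> i). real_polynomial_function g) \<and>
          basic_set (target_desc P \<theta> i) = target_set P \<inter> cell P \<theta> i) \<and>
       (\<forall>k\<in>{1..nT P - 1}. \<forall>(a, b)\<in>neighbours P.
          (\<forall>g\<in>set (iface_desc P \<theta> k a b). real_polynomial_function g) \<and>
          (\<forall>t x u. x \<bullet> normal a b = split_pos P \<theta> a b \<longrightarrow>
             ((t, x, u) \<in> basic_set (iface_desc P \<theta> k a b) \<longleftrightarrow>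
              (t, x, u) \<in> time_int P \<theta> k \<times> (cell P \<theta> a \<inter> cell P \<theta> b) \<times> input_set P))))"


section \<open>The sum-of-squares relaxation\<close>

text \<open>The description of \<open>[T\<^sub>k, T\<^sub>k\<^sub>+\<^sub>1] \<times> X\<^sub>i \<times> U\<close>.\<close>

definition prod_desc :: "('n::finite, 'm::finite, 'p::finite) split_problem
    \<Rightarrow> (real^'p) \<Rightarrow> 'n cell_id \<Rightarrow> nat \<Rightarrow> (real \<times> (real^'n) \<times> (real^'m) \<Rightarrow> real) list" where
  "prod_desc P \<theta> i k = map (\<lambda>g (t, x, u). g t) (time_desc P \<theta> k)
     @ map (\<lambda>g (t, x, u). g x) (cell_desc P \<theta> i) @ map (\<lambda>g (t, x, u). g u) (input_desc P)"

text \<open>\<open>W i\<close> and \<open>V i k\<close> are the coefficient vectors of \<open>w\<^sub>i\<close> and \<open>v\<^sub>i\<^sub>,\<^sub>k\<close>; the sum-of-squares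
  decision variables are those bound in \<open>qmodule\<close>. In the two interface constraints the multiplier
  of \<open>\<plusminus> h\<^sup>T f\<close> is the one belonging to the head of the list.\<close>

definition sos_feasible :: "('n::finite, 'm::finite, 'p::finite) split_problem \<Rightarrow> (real^'p)
    \<Rightarrow> ('n cell_id \<Rightarrow> ((real^'n) \<Rightarrow> nat) \<Rightarrow> real)
    \<Rightarrow> ('n cell_id \<Rightarrow> nat \<Rightarrow> (real \<times> (real^'n) \<Rightarrow> nat) \<Rightarrow> real) \<Rightarrow> bool" where
  "sos_feasible P \<theta> W V \<longleftrightarrow>
    (let d = relax_order P; K = nT P; f = vfield P;
         w = (\<lambda>i. pval (degw P) (W i)); v = (\<lambda>i k. pval (degv P) (V i k))
     in (\<forall>i\<in>cells P.
          (\<forall>k\<in>{1..K - 1}. (\<lambda>z. - lie f (v i k) z) \<in> qmodule d (prod_desc P \<theta> i k)) \<and>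
          (\<lambda>x. w i x - v i 1 (0, x) - 1) \<in> qmodule d (cell_desc P \<theta> i) \<and>
          (\<lambda>x. v i (K - 1) (horizon P, x)) \<in> qmodule d (target_desc P \<theta> i) \<and>
          w i \<in> qmodule d (cell_desc P \<theta> i) \<and>
          (\<forall>k\<in>{1..K - 2}.
             (\<lambda>x. v i k (time_pt P \<theta> (k + 1), x) - v i (k + 1) (time_pt P \<theta> (k + 1), x))
               \<in> qmodule d (cell_desc P \<theta> i))) \<and>
        (\<forall>k\<in>{1..K - 1}. \<forall>(a, b)\<in>neighbours P.
          let \<rho> = restr P \<theta> a b; gs = map (\<lambda>g. g \<circ> \<rho>) (iface_desc P \<theta> k a b);
              va = (\<lambda>(t, x, u). v a k (t, x)) \<circ> \<rho>; vb = (\<lambda>(t, x, u). v b k (t, x)) \<circ> \<rho>;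
              hf = (\<lambda>z. normal a b \<bullet> f z) \<circ> \<rho>
          in (\<lambda>z. va z - vb z) \<in> qmodule d (hf # gs) \<and>
             (\<lambda>z. vb z - va z) \<in> qmodule d ((\<lambda>z. - hf z) # gs)))"

definition moment :: "('n::finite, 'm::finite, 'p::finite) split_problem \<Rightarrow> (real^'p)
    \<Rightarrow> 'n cell_id \<Rightarrow> ((real^'n) \<Rightarrow> nat) \<Rightarrow> real" where
  "moment P \<theta> i \<alpha> = (LINT x:cell P \<theta> i|lborel. monomial \<alpha> x)"

definition sos_objective :: "('n::finite, 'm::finite, 'p::finite) split_problem \<Rightarrow> (real^'p)
    \<Rightarrow> ('n cell_id \<Rightarrow> ((real^'n) \<Rightarrow> nat) \<Rightarrow> real) \<Rightarrow> real" where
  "sos_objective P \<theta> W = (\<Sum>i\<in>cells P. \<Sum>\<alpha>\<in>monoms (degw P). W i \<alpha> * moment P \<theta> i \<alpha>)"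

definition sos_value :: "('n::finite, 'm::finite, 'p::finite) split_problem \<Rightarrow> (real^'p) \<Rightarrow> real" where
  "sos_value P \<theta> = Inf {sos_objective P \<theta> W |W V. sos_feasible P \<theta> W V}"


section \<open>Semidefinite programs in conic form\<close>

definition psd :: "real^'r^'r \<Rightarrow> bool" where
  "psd M \<longleftrightarrow> transpose M = M \<and> (\<forall>v. 0 \<le> v \<bullet> (M *v v))"

text \<open>The rows of all semidefinite blocks are collected in the index type \<open>'r\<close>; \<open>block\<close> assigns
  to a row the block it belongs to, and \<open>entry i j\<close> is the component of the conic vector that
  stores the \<open>(i, j)\<close> entry of the matrix.\<close>

record ('k, 'r) sdp_cone =
  zero_ix :: "'k set"
  free_ix :: "'k set"
  block :: "'r \<Rightarrow> nat"
  entry :: "'r \<Rightarrow> 'r \<Rightarrow> 'k"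

definition valid_cone :: "('k, 'r) sdp_cone \<Rightarrow> bool" where
  "valid_cone C \<longleftrightarrow> zero_ix C \<inter> free_ix C = {} \<and>
     {entry C i j |i j. block C i = block C j} = - (zero_ix C \<union> free_ix C) \<and>
     (\<forall>i j i' j'. block C i = block C j \<and> block C i' = block C j' \<longrightarrow>
        (entry C i j = entry C i' j' \<longleftrightarrow> {i, j} = {i', j'}))"

text \<open>Off-diagonal entries are stored once and scaled by \<open>sqrt 2\<close>, so that the inner product of
  vectors is the trace inner product of matrices.\<close>

definition smat :: "('k::finite, 'r::finite) sdp_cone \<Rightarrow> real^'k \<Rightarrow> real^'r^'r" where
  "smat C s = (\<chi> i j. if block C i \<noteq> block C j then 0
     else if i = j then s $ entry C i i else s $ entry C i j / sqrt 2)"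

definition cone_set :: "('k::finite, 'r::finite) sdp_cone \<Rightarrow> (real^'k) set" where
  "cone_set C = {s. (\<forall>l\<in>zero_ix C. s $ l = 0) \<and> psd (smat C s)}"

definition dual_cone :: "'a::real_inner set \<Rightarrow> 'a set" where
  "dual_cone S = {y. \<forall>s\<in>S. 0 \<le> s \<bullet> y}"

type_synonym ('k, 'l) conic_data = "(real^'l^'k) \<times> (real^'k) \<times> (real^'l)"

definition conic_feasible :: "('k::finite, 'r::finite) sdp_cone \<Rightarrow> ('k, 'l::finite) conic_data
    \<Rightarrow> real^'l \<Rightarrow> real^'k \<Rightarrow> bool" where
  "conic_feasible C = (\<lambda>(A, b, c) x s. A *v x + s = b \<and> s \<in> cone_set C)"

definition pd_solution :: "('k::finite, 'r::finite) sdp_cone \<Rightarrow> ('k, 'l::finite) conic_data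
    \<Rightarrow> real^'l \<Rightarrow> real^'k \<Rightarrow> real^'k \<Rightarrow> bool" where
  "pd_solution C = (\<lambda>(A, b, c) x y s. A *v x + s = b \<and> transpose A *v y + c = 0 \<and> s \<bullet> y = 0 \<and>
     s \<in> cone_set C \<and> y \<in> dual_cone (cone_set C))"

definition block_part :: "('k::finite, 'r::finite) sdp_cone \<Rightarrow> nat \<Rightarrow> real^'r^'r \<Rightarrow> real^'r^'r" where
  "block_part C \<beta> M = (\<chi> i j. if block C i = \<beta> \<and> block C j = \<beta> then M $ i $ j else 0)"

definition strictly_complementary :: "('k::finite, 'r::finite) sdp_cone
    \<Rightarrow> real^'k \<Rightarrow> real^'k \<Rightarrow> bool" where
  "strictly_complementary C y s \<longleftrightarrow> (\<forall>\<beta>\<in>range (block C).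
     rank (block_part C \<beta> (smat C y)) + rank (block_part C \<beta> (smat C s)) = card {i. block C i = \<beta>})"

text \<open>\<open>C\<close> and \<open>D\<close> are a conic form of the relaxation: the coefficients of \<open>w\<close> and \<open>v\<close> are linear
  functions of the conic decision vector \<open>x\<close> (whose remaining components are typically the entries
  of Gram matrices), the feasible \<open>(w, v)\<close> are exactly those obtained from conically feasible \<open>x\<close>,
  and the objectives agree. The cone and the dimensions are the same for all split positions.\<close>

definition conic_form :: "('n::finite, 'm::finite, 'p::finite) split_problem
    \<Rightarrow> ('k::finite, 'r::finite) sdp_cone \<Rightarrow> ((real^'p) \<Rightarrow> ('k, 'l::finite) conic_data) \<Rightarrow> bool" where
  "conic_form P C D \<longleftrightarrow> valid_cone C \<and>
     (\<forall>\<theta>\<in>admissible P. \<exists>\<omega> \<nu>.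
        (\<forall>i \<alpha>. linear (\<lambda>x. \<omega> x i \<alpha>)) \<and> (\<forall>i k \<beta>. linear (\<lambda>x. \<nu> x i k \<beta>)) \<and>
        (\<forall>W V. sos_feasible P \<theta> W V \<longleftrightarrow>
           (\<exists>x s. conic_feasible C (D \<theta>) x s \<and>
              (\<forall>i\<in>cells P. \<forall>\<alpha>\<in>monoms (degw P). W i \<alpha> = \<omega> x i \<alpha>) \<and>
              (\<forall>i\<in>cells P. \<forall>k\<in>{1..nT P - 1}. \<forall>\<beta>\<in>monoms (degv P). V i k \<beta> = \<nu> x i k \<beta>))) \<and>
        (\<forall>x s. conic_feasible C (D \<theta>) x s \<longrightarrow> sos_objective P \<theta> (\<omega> x) = snd (snd (D \<theta>)) \<bullet> x))"


section \<open>The hypotheses at a vector of split positions\<close>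

definition ball_constraint :: "('a::real_normed_vector \<Rightarrow> real) list \<Rightarrow> 'a set \<Rightarrow> bool" where
  "ball_constraint gs S \<longleftrightarrow>
     (\<exists>R. (\<lambda>x. R\<^sup>2 - (norm x)\<^sup>2) \<in> set gs \<and> (\<forall>x\<in>S. 0 \<le> R\<^sup>2 - (norm x)\<^sup>2))"

text \<open>The description of \<open>[T\<^sub>k, T\<^sub>k\<^sub>+\<^sub>1] \<times> X\<^sub>i \<times> U\<close> consists of polynomials in \<open>t\<close>, in \<open>x\<close>
  and in \<open>u\<close> alone, so none of its members can be a ball constraint in \<open>(t, x, u)\<close>; it contains one in
  the form of summands in the separate variables.\<close>

definition ball_constraints :: "('n::finite, 'm::finite, 'p::finite) split_problem \<Rightarrow> (real^'p) \<Rightarrow> bool" where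
  "ball_constraints P \<theta> \<longleftrightarrow>
     (\<forall>i\<in>cells P. \<forall>k\<in>{1..nT P - 1}.
        \<exists>R. \<exists>g1\<in>set (time_desc P \<theta> k). \<exists>g2\<in>set (cell_desc P \<theta> i). \<exists>g3\<in>set (input_desc P).
          (\<forall>t x u. g1 t + g2 x + g3 u = R\<^sup>2 - (norm (t, x, u))\<^sup>2) \<and>
          (\<forall>z \<in> time_int P \<theta> k \<times> cell P \<theta> i \<times> input_set P. 0 \<le> R\<^sup>2 - (norm z)\<^sup>2)) \<and>
     (\<forall>i\<in>cells P. ball_constraint (cell_desc P \<theta> i) (cell P \<theta> i) \<and>
        ball_constraint (target_desc P \<theta> i) (target_set P \<inter> cell P \<theta> i)) \<and>
     (\<forall>k\<in>{1..nT P - 1}. \<forall>(a, b)\<in>neighbours P.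
        ball_constraint (iface_desc P \<theta> k a b)
          (time_int P \<theta> k \<times> (cell P \<theta> a \<inter> cell P \<theta> b) \<times> input_set P))"

definition transversal :: "('n::finite, 'm::finite, 'p::finite) split_problem \<Rightarrow> (real^'p) \<Rightarrow> bool" where
  "transversal P \<theta> \<longleftrightarrow> (\<forall>(a, b)\<in>neighbours P. \<forall>t\<in>{0..horizon P}. \<forall>x\<in>cell P \<theta> a \<inter> cell P \<theta> b.
     \<forall>u\<in>input_set P. normal a b \<bullet> vfield P (t, x, u) \<noteq> 0)"

end

theory Submission
  imports Defs
begin

text \<open>Near an admissible vector of split positions the value of the relaxation is the optimal value
  of the conic program, so by the chain rule it suffices that the optimal value is a differentiable
  function of the data \<open>D = (A, b, c)\<close> at a point \<open>D0\<close> where the primal-dual solution is unique.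

  This is a convex form of the envelope theorem, in the spirit of Gol'shtein. Let \<open>(x, y)\<close> be the
  solution for \<open>D0\<close> and let \<open>L\<^sub>D (x, y) = c \<bullet> x + (A *v x - b) \<bullet> y\<close>. Suppose that data \<open>D\<close> near \<open>D0\<close>
  have a solution \<open>(x', y')\<close>. The saddle point property of the two solutions gives
  \<open>L\<^sub>D (x', y) - L\<^sub>D\<^sub>0 (x', y) \<le> p D - p D0 \<le> L\<^sub>D (x, y') - L\<^sub>D\<^sub>0 (x, y')\<close>
  for the optimal value \<open>p\<close>. As \<open>L\<close> is linear in the data, both bounds are the linear functional
  \<open>D - D0 \<mapsto> L\<^bsub>D - D0\<^esub> (x, y)\<close> up to an error of the order of \<open>norm (D - D0)\<close> times the distance
  of \<open>(x', y')\<close> from \<open>(x, y)\<close>. So that functional is the derivative, provided that solutions of perturbed problems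
  exist and converge to \<open>(x, y)\<close> (\<open>optimal_value_has_derivative\<close>).

  Existence and convergence (\<open>kkt_point_stable\<close>) are obtained together. The optimality
  conditions are a variational inequality for an affine map with skew-symmetric linear part over the closed convex set
  \<open>UNIV \<times> dual_cone K\<close> (\<open>kkt_point_iff_vi\<close>). Intersected with a small ball around \<open>(x, y)\<close>, this set is
  compact, and Brouwer's theorem gives a solution for any data. A solution in the open ball solves
  the original inequality. If there were data tending to \<open>D0\<close> with all these solutions on the
  sphere, a limit point would be a second solution of the localized inequality for \<open>D0\<close>, and
  monotonicity turns that into a second solution of the original one (\<open>unique_vi_solution_local\<close>).\<close>


section \<open>Variational inequalities over closed convex sets\<close>

definition solves_vi :: "('a::euclidean_space \<Rightarrow> 'a) \<Rightarrow> 'a set \<Rightarrow> 'a \<Rightarrow> bool" where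
  "solves_vi F S z \<longleftrightarrow> z \<in> S \<and> (\<forall>w\<in>S. 0 \<le> (w - z) \<bullet> F z)"

text \<open>A point solves the inequality iff it is fixed under a step along \<open>- F\<close> followed by the
  projection to \<open>S\<close>, so Brouwer's theorem applies.\<close>

lemma vi_solution_exists:
  fixes F :: "'a::euclidean_space \<Rightarrow> 'a"
  assumes "compact S" "convex S" "S \<noteq> {}" "continuous_on S F"
  obtains z where "solves_vi F S z"
proof -
  have closed: "closed S"
    using assms(1) by (rule compact_imp_closed)
  let ?p = "\<lambda>z. closest_point S (z - F z)"
  have "continuous_on S (closest_point S \<circ> (\<lambda>z. z - F z))"
    by (intro continuous_on_compose continuous_on_closest_point continuous_intros assms closed)
  moreover have "?p \<in> S \<rightarrow> S"
    using closest_point_in_set[OF closed assms(3)] by auto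
  ultimately obtain z where z: "z \<in> S" "?p z = z"
    using brouwer[OF assms(1-3), of ?p] by (auto simp: o_def)
  have "0 \<le> (w - z) \<bullet> F z" if "w \<in> S" for w
    using closest_point_dot[OF assms(2) closed that, of "z - F z"] z(2)
    by (simp add: inner_diff inner_commute)
  with z(1) have "solves_vi F S z"
    by (simp add: solves_vi_def)
  then show ?thesis ..
qed

text \<open>From an interior point of the ball, a short step towards any point of \<open>M\<close> stays in the ball,
  and the inequality is invariant under scaling of the step.\<close>

lemma vi_local_imp_global:
  assumes "convex M" and sol: "solves_vi F (M \<inter> cball c e) z" and z: "z \<in> ball c e"
  shows "solves_vi F M z"
proof -
  have "0 \<le> (w - z) \<bullet> F z" if w: "w \<in> M" for w
  proof (cases "w = z")
    case False
    \<comment> \<open>the largest step towards \<open>w\<close> that the ball is sure to contain\<close>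
    define t where "t = min 1 ((e - dist c z) / dist z w)"
    have t: "0 < t" "t \<le> 1"
      using z False by (auto simp: t_def)
    have "t * dist z w \<le> e - dist c z"
      using False by (simp add: t_def min_def field_simps)
    moreover have "dist z (z + t *\<^sub>R (w - z)) = t * dist z w"
      using t by (simp add: dist_norm norm_minus_commute)
    ultimately have "dist c (z + t *\<^sub>R (w - z)) \<le> e"
      using dist_triangle[of c "z + t *\<^sub>R (w - z)" z] by linarith
    moreover have "z + t *\<^sub>R (w - z) \<in> M"
      using convexD_alt[OF assms(1) _ w, of z t] sol t
      by (simp add: solves_vi_def algebra_simps)
    ultimately have "0 \<le> (z + t *\<^sub>R (w - z) - z) \<bullet> F z"
      using sol unfolding solves_vi_def by (metis IntI mem_cball)
    then show ?thesis
      using t by (simp add: zero_le_mult_iff)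
  qed simp
  with sol show ?thesis
    by (simp add: solves_vi_def)
qed

text \<open>The solutions of a monotone affine variational inequality form a convex set. So the midpoint of
  \<open>z0\<close> and a solution of the localized inequality solves the localized inequality too; it lies inside
  the ball even if the other solution lies on the sphere, hence it solves the inequality over \<open>M\<close>.\<close>

lemma unique_vi_solution_local:
  assumes "convex M"
    and mono: "\<And>v w. 0 \<le> (v - w) \<bullet> (F v - F w)"
    and mid: "\<And>v w. F ((1/2) *\<^sub>R (v + w)) = (1/2) *\<^sub>R (F v + F w)"
    and z0: "solves_vi F M z0"
    and uniq: "\<And>z. solves_vi F M z \<Longrightarrow> z = z0"
    and "0 < e" and z: "solves_vi F (M \<inter> cball z0 e) z"
  shows "z = z0"
proof -
  define m where "m = (1/2) *\<^sub>R (z0 + z)"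
  have zM: "z \<in> M" "dist z0 z \<le> e" and z0M: "z0 \<in> M"
    using z z0 by (auto simp: solves_vi_def)
  have "0 \<le> (z0 - z) \<bullet> F z"
    using z z0M \<open>0 < e\<close> by (simp add: solves_vi_def)
  moreover have "0 \<le> (z - z0) \<bullet> F z0"
    using z0 zM by (simp add: solves_vi_def)
  \<comment> \<open>The sum of the two nonnegative terms is \<open>- (z - z0) \<bullet> (F z - F z0) \<le> 0\<close>.\<close>
  ultimately have eq: "(z - z0) \<bullet> F z = 0" "(z - z0) \<bullet> F z0 = 0"
    using mono[of z z0] by (simp_all add: inner_diff)
  have mM: "m \<in> M"
    using convexD_alt[OF \<open>convex M\<close> z0M zM(1), of "1/2"] by (simp add: m_def algebra_simps)
  have "dist z0 m = dist z0 z / 2"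
    unfolding m_def dist_norm
    by (metis (no_types, lifting) dist_midpoint(1) dist_norm inverse_eq_divide midpoint_def)
  then have mb: "m \<in> ball z0 e"
    using zM(2) \<open>0 < e\<close> by simp
  have "0 \<le> (w - m) \<bullet> F m" if w: "w \<in> M \<inter> cball z0 e" for w
  proof -
    have w1: "0 \<le> (w - z) \<bullet> F z" and w0: "0 \<le> (w - z0) \<bullet> F z0"
      using w z z0 by (auto simp: solves_vi_def)
    have "w - m = (w - z) + (1/2) *\<^sub>R (z - z0)" "w - m = (w - z0) - (1/2) *\<^sub>R (z - z0)"
      by (simp_all add: m_def algebra_simps flip: scaleR_add_left)
    then have "(w - m) \<bullet> F z = (w - z) \<bullet> F z" "(w - m) \<bullet> F z0 = (w - z0) \<bullet> F z0"
      by (metis eq(1) add.right_neutral inner_add_left inner_scaleR_left mult_zero_right)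
        (metis \<open>w - m = (w - z0) - (1/2) *\<^sub>R (z - z0)\<close> eq(2) diff_zero inner_diff_left inner_scaleR_left mult_zero_right)
    then show ?thesis
      using w0 w1 by (simp add: m_def mid inner_add_right)
  qed
  with mM mb have "solves_vi F (M \<inter> cball z0 e) m"
    by (simp add: solves_vi_def)
  then have "m = z0"
    using vi_local_imp_global[OF \<open>convex M\<close> _ mb] uniq by blast
  with \<open>dist z0 m = dist z0 z / 2\<close> show ?thesis by simp
qed

text \<open>If solvability near \<open>z0\<close> failed for parameters tending to \<open>D0\<close>, the solutions of the
  inequalities localized to \<open>cball z0 e\<close> would all lie on the sphere, and so would a limit point of
  them, which solves the localized inequality for \<open>D0\<close>.\<close>

lemma vi_solution_stable:
  fixes G :: "'d::metric_space \<Rightarrow> 'a::euclidean_space \<Rightarrow> 'a"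
  assumes M: "closed M" "convex M"
    and cont: "continuous_on UNIV (\<lambda>(D, z). G D z)"
    and mono: "\<And>v w. 0 \<le> (v - w) \<bullet> (G D0 v - G D0 w)"
    and mid: "\<And>v w. G D0 ((1/2) *\<^sub>R (v + w)) = (1/2) *\<^sub>R (G D0 v + G D0 w)"
    and z0: "solves_vi (G D0) M z0"
    and uniq: "\<And>z. solves_vi (G D0) M z \<Longrightarrow> z = z0"
    and "0 < e"
  shows "\<forall>\<^sub>F D in nhds D0. \<exists>z\<in>ball z0 e. solves_vi (G D) M z"
proof (rule ccontr)
  assume "\<not> ?thesis"
  then have "\<exists>D. dist D D0 < inverse (real (Suc n)) \<and> \<not> (\<exists>z\<in>ball z0 e. solves_vi (G D) M z)" for n
    unfolding eventually_nhds_metric by (metis inverse_positive_iff_positive of_nat_0_less_iff zero_less_Suc)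
  then have "\<forall>n. \<exists>D. dist D D0 < inverse (real (Suc n)) \<and> \<not> (\<exists>z\<in>ball z0 e. solves_vi (G D) M z)"
    by blast
  from choice[OF this] obtain D where D: "\<And>n. dist (D n) D0 < inverse (real (Suc n))"
    and none: "\<And>n z. z \<in> ball z0 e \<Longrightarrow> \<not> solves_vi (G (D n)) M z"
    by blast
  have "D \<longlonglongrightarrow> D0"
    by (rule iffD2[OF tendsto_dist_iff], rule tendsto_sandwich[OF _ _ tendsto_const LIMSEQ_inverse_real_of_nat])
      (use D in \<open>auto intro!: always_eventually less_imp_le\<close>)
  define S where "S = M \<inter> cball z0 e"
  have S: "compact S" "convex S" "S \<noteq> {}"
    using M z0 \<open>0 < e\<close> by (auto simp: S_def solves_vi_def closed_Int_compact convex_Int)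
  have contG: "continuous_on UNIV (G D')" for D'
  proof -
    have "continuous_on UNIV ((\<lambda>(D, z). G D z) \<circ> Pair D')"
      by (intro continuous_on_compose continuous_intros continuous_on_subset[OF cont]) auto
    then show ?thesis by (simp add: o_def)
  qed
  have "\<exists>z. solves_vi (G (D n)) S z" for n
    using vi_solution_exists[OF S continuous_on_subset[OF contG]] by (metis subset_UNIV)
  then obtain z where z: "\<And>n. solves_vi (G (D n)) S (z n)"
    by metis
  \<comment> \<open>Otherwise \<open>z n\<close> would lie in the open ball and solve the inequality over \<open>M\<close>.\<close>
  have sphere: "dist z0 (z n) = e" for n
    using z[of n] none[of "z n" n] vi_local_imp_global[OF M(2), of "G (D n)" z0 e "z n"]
    by (force simp: S_def solves_vi_def)
  obtain l r where l: "l \<in> S" and r: "strict_mono r" and lim: "(z \<circ> r) \<longlonglongrightarrow> l"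
    using S(1) z unfolding compact_def solves_vi_def by metis
  have DR: "(D \<circ> r) \<longlonglongrightarrow> D0"
    using \<open>D \<longlonglongrightarrow> D0\<close> r by (rule LIMSEQ_subseq_LIMSEQ)
  have "isCont (\<lambda>(D, z). G D z) (D0, l)"
    using cont by (simp add: continuous_on_eq_continuous_at)
  from isCont_tendsto_compose[OF this tendsto_Pair[OF DR lim]]
  have Glim: "(\<lambda>n. G (D (r n)) (z (r n))) \<longlonglongrightarrow> G D0 l"
    by simp
  have "0 \<le> (w - l) \<bullet> G D0 l" if "w \<in> S" for w
  proof (rule tendsto_lowerbound)
    show "(\<lambda>n. (w - z (r n)) \<bullet> G (D (r n)) (z (r n))) \<longlonglongrightarrow> (w - l) \<bullet> G D0 l"
      using lim by (intro tendsto_intros Glim) (simp add: o_def)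
    show "\<forall>\<^sub>F n in sequentially. 0 \<le> (w - z (r n)) \<bullet> G (D (r n)) (z (r n))"
      using z that by (auto simp: solves_vi_def)
  qed simp
  with l have "solves_vi (G D0) (M \<inter> cball z0 e) l"
    by (simp add: solves_vi_def S_def)
  from unique_vi_solution_local[OF M(2) mono mid z0 uniq \<open>0 < e\<close> this]
  have "l = z0" .
  moreover have "(\<lambda>n. dist z0 ((z \<circ> r) n)) \<longlonglongrightarrow> dist z0 l"
    by (intro tendsto_intros lim)
  then have "dist z0 l = e"
    by (simp add: sphere LIMSEQ_const_iff)
  ultimately show False
    using \<open>0 < e\<close> by simp
qed


section \<open>Optimality conditions of conic programs\<close>

lemma dual_cone_closed: "closed (dual_cone K)"
proof -
  have "dual_cone K = (\<Inter>s\<in>K. {y. 0 \<le> s \<bullet> y})"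
    by (auto simp: dual_cone_def)
  then show ?thesis
    by (simp add: closed_INT closed_Collect_le continuous_intros)
qed

lemma dual_cone_add: "y \<in> dual_cone K \<Longrightarrow> z \<in> dual_cone K \<Longrightarrow> y + z \<in> dual_cone K"
  by (simp add: dual_cone_def inner_add_right)

lemma dual_cone_scaleR: "y \<in> dual_cone K \<Longrightarrow> 0 \<le> a \<Longrightarrow> a *\<^sub>R y \<in> dual_cone K"
  by (simp add: dual_cone_def)

lemma dual_cone_convex: "convex (dual_cone K)"
  by (auto intro!: convexI dual_cone_add dual_cone_scaleR)

text \<open>A hyperplane separating \<open>s\<close> from \<open>K\<close> can be taken through the apex of the cone, and its normal is
  then a dual vector that is negative on \<open>s\<close>.\<close>

lemma bipolar:
  fixes K :: "'a::euclidean_space set"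
  assumes "closed K" "convex K" "cone K" "0 \<in> K"
    and pos: "\<And>y. y \<in> dual_cone K \<Longrightarrow> 0 \<le> s \<bullet> y"
  shows "s \<in> K"
proof (rule ccontr)
  assume "s \<notin> K"
  then obtain a \<beta> where a: "a \<bullet> s < \<beta>" "\<And>v. v \<in> K \<Longrightarrow> \<beta> < a \<bullet> v"
    using separating_hyperplane_closed_point[OF assms(2,1)] by metis
  have "\<beta> < 0"
    using a(2)[OF assms(4)] by simp
  have "0 \<le> v \<bullet> a" if "v \<in> K" for v
  proof (rule ccontr)
    assume "\<not> 0 \<le> v \<bullet> a"
    then have "a \<bullet> v < 0" by (simp add: inner_commute)
    \<comment> \<open>the multiple of \<open>v\<close> that lies on the separating hyperplane\<close>
    moreover have "(\<beta> / (a \<bullet> v)) *\<^sub>R v \<in> K"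
      using that assms(3) \<open>a \<bullet> v < 0\<close> \<open>\<beta> < 0\<close> by (simp add: cone_def divide_nonpos_nonpos)
    ultimately show False
      using a(2) by force
  qed
  then have "0 \<le> s \<bullet> a"
    by (intro pos) (simp add: dual_cone_def)
  with a(1) \<open>\<beta> < 0\<close> show False
    by (simp add: inner_commute)
qed

lemma norm_matrix_vector_mult_le:
  fixes A :: "real^'l::finite^'k::finite"
  shows "norm (A *v x) \<le> norm A * norm x"
proof -
  have "\<bar>(A *v x) $ i\<bar> \<le> norm (A $ i) * norm x" for i
    by (simp add: matrix_vector_mul_component Cauchy_Schwarz_ineq2)
  then have "norm (A *v x) \<le> L2_set (\<lambda>i. norm (A $ i) * norm x) UNIV"
    by (simp add: norm_vec_def[of "A *v x"] L2_set_mono)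
  then show ?thesis
    by (simp add: norm_vec_def[of A] L2_set_left_distrib)
qed

lemma bounded_bilinear_matrix_vector_mult:
  "bounded_bilinear ((*v) :: real^'l::finite^'k::finite \<Rightarrow> _)"
proof
  show "\<exists>K. \<forall>(A :: real^'l^'k) x. norm (A *v x) \<le> norm A * norm x * K"
    by (rule exI[of _ 1]) (simp add: norm_matrix_vector_mult_le)
qed (simp_all add: matrix_vector_mult_add_rdistrib matrix_vector_right_distrib
    scaleR_matrix_vector_assoc matrix_vector_mult_scaleR)

text \<open>The gradient in \<open>x\<close> and the negative gradient in \<open>y\<close> of the Lagrangian \<open>c \<bullet> x + (A *v x - b) \<bullet> y\<close>,
  whose saddle points over \<open>UNIV \<times> dual_cone K\<close> are the primal-dual solutions.\<close>

definition kkt_map :: "('k::finite, 'l::finite) conic_data \<Rightarrow> (real^'l) \<times> (real^'k) \<Rightarrow> (real^'l) \<times> (real^'k)" where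
  "kkt_map = (\<lambda>(A, b, c) (x, y). (transpose A *v y + c, b - A *v x))"

text \<open>A primal-dual solution, with the slack \<open>s\<close> eliminated by \<open>s = b - A *v x\<close>.\<close>

definition kkt_point :: "(real^'k) set \<Rightarrow> ('k::finite, 'l::finite) conic_data \<Rightarrow> (real^'l) \<times> (real^'k) \<Rightarrow> bool" where
  "kkt_point K = (\<lambda>(A, b, c) (x, y). transpose A *v y + c = 0 \<and> y \<in> dual_cone K \<and>
     b - A *v x \<in> K \<and> (b - A *v x) \<bullet> y = 0)"

lemma inner_transpose_mult:
  fixes A :: "real^'l::finite^'k::finite"
  shows "x \<bullet> (transpose A *v y) = (A *v x) \<bullet> y"
  by (metis dot_lmul_matrix inner_commute transpose_matrix_vector)

text \<open>In the variational inequality \<open>x\<close> is unconstrained, which forces the first component of the map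
  to vanish; testing with \<open>0\<close>, \<open>2 y\<close> and \<open>y + w\<close> for \<open>w\<close> in the dual cone gives complementarity and,
  by the bipolar theorem, primal feasibility.\<close>

lemma kkt_point_iff_vi:
  fixes K :: "(real^'k::finite) set"
  assumes K: "closed K" "convex K" "cone K" "0 \<in> K"
  shows "kkt_point K D z \<longleftrightarrow> solves_vi (kkt_map D) (UNIV \<times> dual_cone K) z"
proof -
  obtain A b c x y where Dz: "D = (A, b, c)" "z = (x, y)"
    by (metis prod.exhaust)
  let ?r = "transpose A *v y + c" and ?s = "b - A *v x"
  show ?thesis
  proof
    assume "kkt_point K D z"
    then have r: "?r = 0" and y: "y \<in> dual_cone K" and s: "?s \<in> K" "?s \<bullet> y = 0"
      by (auto simp: kkt_point_def Dz)
    have "0 \<le> (w - y) \<bullet> ?s" if "w \<in> dual_cone K" for w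
    proof -
      have "0 \<le> ?s \<bullet> w"
        using that s(1) by (auto simp: dual_cone_def)
      also have "\<dots> = (w - y) \<bullet> ?s"
        using s(2) by (simp only: inner_diff_left[of w y] inner_commute[of ?s] diff_zero)
      finally show ?thesis .
    qed
    with r y show "solves_vi (kkt_map D) (UNIV \<times> dual_cone K) z"
      by (auto simp: solves_vi_def kkt_map_def Dz)
  next
    assume vi: "solves_vi (kkt_map D) (UNIV \<times> dual_cone K) z"
    then have y: "y \<in> dual_cone K"
      and le: "\<And>u w. w \<in> dual_cone K \<Longrightarrow> 0 \<le> (u - x) \<bullet> ?r + (w - y) \<bullet> ?s"
      by (auto simp: solves_vi_def kkt_map_def Dz)
    have "0 \<le> - (?r \<bullet> ?r)"
      using le[OF y, of "x - ?r"] by (simp del: transpose_matrix_vector flip: inner_minus_left)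
    then have r: "?r = 0"
      by (metis inner_gt_zero_iff neg_0_le_iff_le not_less)
    have le': "0 \<le> (w - y) \<bullet> ?s" if "w \<in> dual_cone K" for w
      using le[OF that, of x] by simp
    have "0 \<in> dual_cone K"
      by (simp add: dual_cone_def)
    from le'[OF this] le'[OF dual_cone_add[OF y y]] have s: "?s \<bullet> y = 0"
      by (simp add: inner_commute)
    have "?s \<in> K"
    proof (rule bipolar[OF K])
      show "0 \<le> ?s \<bullet> w" if "w \<in> dual_cone K" for w
        using le'[OF dual_cone_add[OF that y]] by (simp add: inner_commute)
    qed
    with r y s show "kkt_point K D z"
      by (simp add: kkt_point_def Dz)
  qed
qed

text \<open>The blocks \<open>A\<^sup>T\<close> and \<open>- A\<close> of the linear part cancel, which is monotonicity with equality.\<close>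

lemma kkt_map_skew: "(v - w) \<bullet> (kkt_map D v - kkt_map D w) = 0"
proof -
  obtain A b c x y x' y' where eq: "D = (A, b, c)" "v = (x, y)" "w = (x', y')"
    by (metis prod.exhaust)
  have "(v - w) \<bullet> (kkt_map D v - kkt_map D w)
      = (x - x') \<bullet> (transpose A *v (y - y')) - (y - y') \<bullet> (A *v (x - x'))"
    unfolding kkt_map_def eq
    by (simp add: matrix_vector_mult_diff_distrib inner_diff_right del: transpose_matrix_vector)
  then show ?thesis
    by (simp only: inner_transpose_mult) (simp add: inner_commute)
qed

lemma kkt_map_midpoint:
  "kkt_map D ((1/2) *\<^sub>R (v + w)) = (1/2) *\<^sub>R (kkt_map D v + kkt_map D w)"
proof -
  obtain A b c x y x' y' where eq: "D = (A, b, c)" "v = (x, y)" "w = (x', y')"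
    by (metis prod.exhaust)
  show ?thesis
    by (simp add: eq kkt_map_def matrix_vector_right_distrib matrix_vector_mult_scaleR vec_eq_iff
        del: transpose_matrix_vector)
      (simp add: field_simps del: transpose_matrix_vector)
qed

lemma continuous_kkt_map:
  "continuous_on UNIV (\<lambda>(D, z). kkt_map D z)"
proof -
  have lin: "linear (transpose :: real^'l::finite^'k::finite \<Rightarrow> _)"
    by (intro linearI) (simp_all add: transpose_def vec_eq_iff)
  have tr: "continuous_on S (\<lambda>z. transpose (f z))"
    if "continuous_on S f" for S :: "'z::topological_space set" and f :: "_ \<Rightarrow> real^'l::finite^'k::finite"
    by (rule bounded_linear.continuous_on[OF _ that])
      (use lin in \<open>simp add: linear_conv_bounded_linear\<close>)
  have eq: "(\<lambda>(D, z). kkt_map D z) = (\<lambda>p :: ('k::finite, 'l::finite) conic_data \<times> _.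
      (transpose (fst (fst p)) *v snd (snd p) + snd (snd (fst p)),
       fst (snd (fst p)) - fst (fst p) *v fst (snd p)))"
    by (auto simp: kkt_map_def fun_eq_iff)
  show ?thesis
    unfolding eq by (intro continuous_intros tr
      bounded_bilinear.continuous_on[OF bounded_bilinear_matrix_vector_mult])
qed

lemma kkt_point_stable:
  fixes K :: "(real^'k::finite) set"
  assumes K: "closed K" "convex K" "cone K" "0 \<in> K"
    and "kkt_point K (D0 :: ('k, 'l::finite) conic_data) z0"
    and "\<And>z. kkt_point K D0 z \<Longrightarrow> z = z0" "0 < e"
  shows "\<forall>\<^sub>F D in nhds D0. \<exists>z\<in>ball z0 e. kkt_point K D z"
  unfolding kkt_point_iff_vi[OF K]
proof (rule vi_solution_stable)
  show "closed (UNIV \<times> dual_cone K :: ((real^'l) \<times> (real^'k)) set)"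
    by (intro closed_Times closed_UNIV dual_cone_closed)
  show "convex (UNIV \<times> dual_cone K :: ((real^'l) \<times> (real^'k)) set)"
    by (intro convex_Times convex_UNIV dual_cone_convex)
  show "0 \<le> (v - w) \<bullet> (kkt_map D0 v - kkt_map D0 w)" for v w
    by (simp only: kkt_map_skew)
  show "solves_vi (kkt_map D0) (UNIV \<times> dual_cone K) z0"
    using assms(5) by (simp only: kkt_point_iff_vi[OF K])
  show "z = z0" if "solves_vi (kkt_map D0) (UNIV \<times> dual_cone K) z" for z
    using assms(6) that by (simp only: kkt_point_iff_vi[OF K])
qed (rule continuous_kkt_map kkt_map_midpoint \<open>0 < e\<close>)+


section \<open>Differentiability of the optimal value\<close>

definition optimal_value :: "(real^'k) set \<Rightarrow> ('k::finite, 'l::finite) conic_data \<Rightarrow> real" where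
  "optimal_value K = (\<lambda>(A, b, c). Inf {c \<bullet> x |x. b - A *v x \<in> K})"

text \<open>The point comes before the data: as a function of the data the Lagrangian is linear, and it is
  the derivative of the optimal value.\<close>

definition lagrangian :: "(real^'l) \<times> (real^'k) \<Rightarrow> ('k::finite, 'l::finite) conic_data \<Rightarrow> real" where
  "lagrangian = (\<lambda>(x, y) (A, b, c). c \<bullet> x + (A *v x - b) \<bullet> y)"

lemma lagrangian_le_objective:
  assumes "y \<in> dual_cone K" "b - A *v x \<in> K"
  shows "lagrangian (x, y) (A, b, c) \<le> c \<bullet> x"
proof -
  have "0 \<le> (b - A *v x) \<bullet> y"
    using assms by (simp add: dual_cone_def)
  then show ?thesis
    by (simp add: lagrangian_def inner_diff_left)
qed

lemma lagrangian_dual_feasible: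
  assumes "transpose A *v y + c = 0"
  shows "lagrangian (x, y) (A, b, c) = - (b \<bullet> y)"
proof -
  have "c \<bullet> x = - ((A *v x) \<bullet> y)"
    using assms by (metis add_eq_0_iff inner_commute inner_minus_right inner_transpose_mult)
  then show ?thesis
    by (simp add: lagrangian_def inner_diff_left)
qed

text \<open>A solution is a saddle point of the Lagrangian. In addition, dual feasibility makes the
  Lagrangian independent of the primal variable, so the middle equation holds for every \<open>x'\<close>.\<close>

lemma kkt_point_saddle:
  assumes "kkt_point K D (x, y)"
  shows "fst (snd D) - fst D *v x' \<in> K \<Longrightarrow> lagrangian (x', y) D \<le> snd (snd D) \<bullet> x'"
    and "lagrangian (x', y) D = snd (snd D) \<bullet> x"
    and "y' \<in> dual_cone K \<Longrightarrow> lagrangian (x, y') D \<le> snd (snd D) \<bullet> x"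
proof -
  obtain A b c where D: "D = (A, b, c)" by (metis prod.exhaust)
  have *: "transpose A *v y + c = 0" "y \<in> dual_cone K" "b - A *v x \<in> K" "(b - A *v x) \<bullet> y = 0"
    using assms by (auto simp: kkt_point_def D)
  show "fst (snd D) - fst D *v x' \<in> K \<Longrightarrow> lagrangian (x', y) D \<le> snd (snd D) \<bullet> x'"
    using lagrangian_le_objective *(2) by (simp add: D)
  show "y' \<in> dual_cone K \<Longrightarrow> lagrangian (x, y') D \<le> snd (snd D) \<bullet> x"
    using lagrangian_le_objective *(3) by (simp add: D)
  have "lagrangian (x', y) D = lagrangian (x, y) D"
    by (simp only: D lagrangian_dual_feasible[OF *(1)])
  also have "\<dots> = c \<bullet> x"
    using *(4) by (simp add: D lagrangian_def inner_diff_left)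
  finally show "lagrangian (x', y) D = snd (snd D) \<bullet> x"
    by (simp add: D)
qed

text \<open>Weak duality: the multiplier \<open>y\<close> certifies that \<open>x\<close> attains the infimum.\<close>

lemma optimal_value_kkt:
  assumes "kkt_point K D (x, y)"
  shows "optimal_value K D = snd (snd D) \<bullet> x"
proof -
  have "snd (snd D) \<bullet> x \<le> snd (snd D) \<bullet> x'" if "fst (snd D) - fst D *v x' \<in> K" for x'
    using kkt_point_saddle(1,2)[OF assms] that by metis
  then have "Inf {snd (snd D) \<bullet> x' |x'. fst (snd D) - fst D *v x' \<in> K} = snd (snd D) \<bullet> x"
    using assms by (intro cInf_eq_minimum) (auto simp: kkt_point_def split: prod.splits)
  then show ?thesis
    by (simp add: optimal_value_def case_prod_beta)
qed

lemma lagrangian_linear: "bounded_linear (lagrangian z)"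
proof -
  have "linear (lagrangian z)"
    by (intro linearI) (auto simp: lagrangian_def algebra_simps inner_add_left inner_diff_left
        matrix_vector_mult_add_rdistrib scaleR_matrix_vector_assoc[symmetric] split: prod.splits)
  then show ?thesis
    by (simp add: linear_conv_bounded_linear)
qed

lemma lagrangian_primal_lipschitz:
  "\<bar>lagrangian (x', y) D - lagrangian (x, y) D\<bar> \<le> norm D * norm (x' - x) * (1 + norm y)"
proof -
  obtain A b c where D: "D = (A, b, c)" by (metis prod.exhaust)
  have n: "norm A \<le> norm D" "norm c \<le> norm D"
    unfolding D by (metis norm_fst_le fst_conv, metis norm_snd_le order_trans snd_conv)
  have "lagrangian (x', y) D - lagrangian (x, y) D = c \<bullet> (x' - x) + (A *v (x' - x)) \<bullet> y"
    by (simp add: D lagrangian_def matrix_vector_mult_diff_distrib inner_diff_left inner_diff_right)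
  also have "\<bar>\<dots>\<bar> \<le> norm c * norm (x' - x) + norm (A *v (x' - x)) * norm y"
    by (intro order_trans[OF abs_triangle_ineq] add_mono Cauchy_Schwarz_ineq2)
  also have "\<dots> \<le> norm D * norm (x' - x) + (norm D * norm (x' - x)) * norm y"
    using n by (intro add_mono mult_right_mono order_trans[OF norm_matrix_vector_mult_le]) auto
  finally show ?thesis by (simp add: algebra_simps)
qed

lemma lagrangian_dual_lipschitz:
  "\<bar>lagrangian (x, y') D - lagrangian (x, y) D\<bar> \<le> norm D * norm (y' - y) * (1 + norm x)"
proof -
  obtain A b c where D: "D = (A, b, c)" by (metis prod.exhaust)
  have n: "norm A \<le> norm D" "norm b \<le> norm D"
    unfolding D by (metis norm_fst_le fst_conv, metis norm_fst_le norm_snd_le order_trans fst_conv snd_conv)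
  have "lagrangian (x, y') D - lagrangian (x, y) D = (A *v x - b) \<bullet> (y' - y)"
    by (simp add: D lagrangian_def inner_diff_left inner_diff_right)
  also have "\<bar>\<dots>\<bar> \<le> norm (A *v x - b) * norm (y' - y)"
    by (rule Cauchy_Schwarz_ineq2)
  also have "\<dots> \<le> (norm D * norm x + norm D) * norm (y' - y)"
    using n norm_matrix_vector_mult_le[of A x] mult_right_mono[OF n(1), of "norm x"]
    by (intro mult_right_mono order_trans[OF norm_triangle_ineq4]) auto
  finally show ?thesis by (simp add: algebra_simps)
qed

text \<open>The difference of the optimal values is squeezed between two values of the Lagrangian at
  \<open>D - D0\<close>, taken at \<open>(x', y)\<close> and \<open>(x, y')\<close>; both points are close to \<open>z0 = (x, y)\<close>.\<close>

theorem optimal_value_has_derivative: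
  fixes K :: "(real^'k::finite) set"
  assumes K: "closed K" "convex K" "cone K" "0 \<in> K"
    and z0: "kkt_point K D0 z0" and uniq: "\<And>z. kkt_point K D0 z \<Longrightarrow> z = z0"
  shows "(optimal_value K has_derivative lagrangian z0) (at D0)"
  unfolding has_derivative_at_alt
proof (intro conjI lagrangian_linear allI impI)
  fix e :: real assume "0 < e"
  obtain x y where xy: "z0 = (x, y)" by (cases z0)
  \<comment> \<open>a common Lipschitz constant, per unit of \<open>norm (D - D0)\<close>, of both one-sided perturbations\<close>
  define B where "B = 1 + norm x + norm y"
  have "0 < B" by (simp add: B_def add_pos_nonneg)
  with \<open>0 < e\<close> have "\<forall>\<^sub>F D in nhds D0. \<exists>z\<in>ball z0 (e / B). kkt_point K D z"
    by (intro kkt_point_stable[OF K z0 uniq]) auto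
  then obtain d where "0 < d"
    and d: "\<And>D. dist D D0 < d \<Longrightarrow> \<exists>z\<in>ball z0 (e / B). kkt_point K D z"
    unfolding eventually_nhds_metric by metis
  have "norm (optimal_value K D - optimal_value K D0 - lagrangian z0 (D - D0)) \<le> e * norm (D - D0)"
    if D: "norm (D - D0) < d" for D
  proof -
    obtain z where z: "z \<in> ball z0 (e / B)" "kkt_point K D z"
      using d[of D] D unfolding dist_norm by blast
    obtain x' y' where "z = (x', y')" by (cases z)
    with z have near: "dist (x, y) (x', y') < e / B" and kkt: "kkt_point K D (x', y')"
      by (simp_all add: xy)
    have kkt0: "kkt_point K D0 (x, y)"
      using z0 by (simp add: xy)
    have "norm ((x', y') - (x, y)) < e / B"
      using near by (simp add: dist_commute dist_norm)
    then have nx: "norm (x' - x) \<le> e / B" and ny: "norm (y' - y) \<le> e / B"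
      using norm_fst_le[of "x' - x" "y' - y"] norm_snd_le[of "y' - y" "x' - x"] by auto
    have feas: "fst (snd D) - fst D *v x' \<in> K" "y' \<in> dual_cone K" "y \<in> dual_cone K"
      using kkt kkt0 by (auto simp: kkt_point_def split: prod.splits)
    let ?\<Delta> = "optimal_value K D - optimal_value K D0"
    have diff: "lagrangian z (D - D0) = lagrangian z D - lagrangian z D0" for z
      using lagrangian_linear[of z] by (simp add: linear_simps)
    have "lagrangian (x', y) D \<le> optimal_value K D"
      using lagrangian_le_objective[OF feas(3,1), of "snd (snd D)"]
      by (simp add: optimal_value_kkt[OF kkt])
    moreover have "lagrangian (x', y) D0 = optimal_value K D0"
      by (simp add: kkt_point_saddle(2)[OF kkt0] optimal_value_kkt[OF kkt0])
    ultimately have lower: "lagrangian (x', y) (D - D0) \<le> ?\<Delta>"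
      by (simp add: diff)
    have "lagrangian (x, y') D0 \<le> optimal_value K D0"
      using kkt_point_saddle(3)[OF kkt0 feas(2)] by (simp add: optimal_value_kkt[OF kkt0])
    moreover have "lagrangian (x, y') D = optimal_value K D"
      by (simp add: kkt_point_saddle(2)[OF kkt] optimal_value_kkt[OF kkt])
    ultimately have upper: "?\<Delta> \<le> lagrangian (x, y') (D - D0)"
      by (simp add: diff)
    have bound: "norm (D - D0) * r * (1 + q) \<le> e * norm (D - D0)"
      if "r \<le> e / B" "1 + q \<le> B" "0 \<le> q" for r q
    proof -
      have "r * (1 + q) \<le> e / B * B"
        using that \<open>0 < B\<close> \<open>0 < e\<close> by (intro mult_mono) auto
      also have "\<dots> = e"
        using \<open>0 < B\<close> by simp
      finally have "norm (D - D0) * (r * (1 + q)) \<le> norm (D - D0) * e"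
        by (rule mult_left_mono) simp
      then show ?thesis
        by (simp only: mult_ac)
    qed
    have "\<bar>lagrangian (x', y) (D - D0) - lagrangian z0 (D - D0)\<bar> \<le> e * norm (D - D0)"
      unfolding xy by (rule order_trans[OF lagrangian_primal_lipschitz bound[OF nx]]) (simp_all add: B_def)
    moreover have "\<bar>lagrangian (x, y') (D - D0) - lagrangian z0 (D - D0)\<bar> \<le> e * norm (D - D0)"
      unfolding xy by (rule order_trans[OF lagrangian_dual_lipschitz bound[OF ny]]) (simp_all add: B_def)
    ultimately show ?thesis
      using lower upper unfolding real_norm_def by linarith
  qed
  with \<open>0 < d\<close> show "\<exists>d>0. \<forall>D. norm (D - D0) < d \<longrightarrow>
      norm (optimal_value K D - optimal_value K D0 - lagrangian z0 (D - D0)) \<le> e * norm (D - D0)"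
    by blast
qed


section \<open>The sum-of-squares relaxation\<close>

lemma cone_set_closed: "closed (cone_set C)"
proof -
  have ent: "continuous_on UNIV (\<lambda>s. smat C s $ i $ j)" for i j
    by (cases "block C i = block C j"; cases "i = j") (auto simp: smat_def intro!: continuous_intros)
  have eq: "cone_set C = (\<Inter>l\<in>zero_ix C. {s. s $ l = 0}) \<inter>
      (\<Inter>i. \<Inter>j. {s. smat C s $ i $ j = smat C s $ j $ i}) \<inter>
      (\<Inter>v. {s. 0 \<le> (\<Sum>i\<in>UNIV. v $ i * (\<Sum>j\<in>UNIV. smat C s $ i $ j * v $ j))})"
    by (auto simp: cone_set_def psd_def transpose_def vec_eq_iff inner_vec_def matrix_vector_mult_def)
  show ?thesis
    unfolding eq by (intro closed_Int closed_INT ballI closed_Collect_eq closed_Collect_le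
        continuous_intros ent)
qed

lemma smat_add: "smat C (s + t) = smat C s + smat C t"
  by (simp add: smat_def vec_eq_iff add_divide_distrib)

lemma smat_scaleR: "smat C (a *\<^sub>R s) = a *\<^sub>R smat C s"
  by (simp add: smat_def vec_eq_iff)

lemma cone_set_add: "s \<in> cone_set C \<Longrightarrow> t \<in> cone_set C \<Longrightarrow> s + t \<in> cone_set C"
  by (auto simp: cone_set_def psd_def smat_add matrix_vector_mult_add_rdistrib inner_add_right
      transpose_def vec_eq_iff)

lemma cone_set_scaleR: "s \<in> cone_set C \<Longrightarrow> 0 \<le> a \<Longrightarrow> a *\<^sub>R s \<in> cone_set C"
  by (auto simp: cone_set_def psd_def smat_scaleR transpose_def vec_eq_iff
      simp flip: scaleR_matrix_vector_assoc)

lemma zero_in_cone_set: "0 \<in> cone_set C"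
  by (auto simp: cone_set_def psd_def smat_def transpose_def vec_eq_iff matrix_vector_mult_def inner_vec_def
      cong: if_cong)

lemma cone_set_convex: "convex (cone_set C)"
  by (auto intro!: convexI cone_set_add cone_set_scaleR)

lemma cone_set_cone: "cone (cone_set C)"
  by (auto simp: cone_def intro!: cone_set_scaleR)

lemma pd_solution_iff_kkt_point:
  "pd_solution C D x y s \<longleftrightarrow>
    kkt_point (cone_set C) D (x, y) \<and> s = fst (snd D) - fst D *v x"
  by (cases D) (auto simp: pd_solution_def kkt_point_def algebra_simps)

lemma open_admissible: "open (admissible P)"
proof -
  have t: "continuous_on UNIV (\<lambda>\<theta>. time_pt P \<theta> k)" for k
    by (cases "k \<le> 1"; cases "nT P \<le> k") (auto simp: time_pt_def intro!: continuous_intros)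
  have g: "continuous_on UNIV (\<lambda>\<theta>. grid_pt P \<theta> j l)" for j l
    by (cases "l = 0"; cases "ncuts P j < l") (auto simp: grid_pt_def intro!: continuous_intros)
  have eq: "admissible P = (\<Inter>k\<in>{1..nT P - 1}. {\<theta>. time_pt P \<theta> k < time_pt P \<theta> (Suc k)}) \<inter>
      (\<Inter>j. \<Inter>l\<in>{..ncuts P j}. {\<theta>. grid_pt P \<theta> j l < grid_pt P \<theta> j (Suc l)})"
    by (auto simp: admissible_def)
  show ?thesis
    unfolding eq by (intro open_Int open_INT ballI open_Collect_less t g) auto
qed

text \<open>The two infima are over the same set of numbers: the objective of the relaxation only reads the
  coefficients on which \<open>W\<close> and the image of the conic vector agree.\<close>

lemma sos_value_eq_optimal_value:
  assumes "conic_form P C D" "\<theta> \<in> admissible P"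
  shows "sos_value P \<theta> = optimal_value (cone_set C) (D \<theta>)"
proof -
  obtain A b c where D: "D \<theta> = (A, b, c)"
    by (metis prod.exhaust)
  obtain \<omega> \<nu> where feas: "\<And>W V. sos_feasible P \<theta> W V \<longleftrightarrow>
           (\<exists>x s. conic_feasible C (D \<theta>) x s \<and>
              (\<forall>i\<in>cells P. \<forall>\<alpha>\<in>monoms (degw P). W i \<alpha> = \<omega> x i \<alpha>) \<and>
              (\<forall>i\<in>cells P. \<forall>k\<in>{1..nT P - 1}. \<forall>\<beta>\<in>monoms (degv P). V i k \<beta> = \<nu> x i k \<beta>))"
    and obj: "\<And>x s. conic_feasible C (D \<theta>) x s \<Longrightarrow> sos_objective P \<theta> (\<omega> x) = c \<bullet> x"
    using bspec[OF conjunct2[OF assms(1)[unfolded conic_form_def]] assms(2)] unfolding D snd_conv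
    by blast
  have cf: "conic_feasible C (D \<theta>) x s \<longleftrightarrow> s = b - A *v x \<and> b - A *v x \<in> cone_set C" for x s
    by (auto simp: conic_feasible_def D algebra_simps)
  have "{sos_objective P \<theta> W |W V. sos_feasible P \<theta> W V} = {c \<bullet> x |x. b - A *v x \<in> cone_set C}"
  proof (intro equalityI subsetI)
    fix p assume "p \<in> {sos_objective P \<theta> W |W V. sos_feasible P \<theta> W V}"
    then obtain W x s where p: "p = sos_objective P \<theta> W" and x: "conic_feasible C (D \<theta>) x s"
      and W: "\<forall>i\<in>cells P. \<forall>\<alpha>\<in>monoms (degw P). W i \<alpha> = \<omega> x i \<alpha>"
      using feas by blast
    have "p = sos_objective P \<theta> (\<omega> x)"
      unfolding p sos_objective_def using W by (intro sum.cong refl) simp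
    then show "p \<in> {c \<bullet> x |x. b - A *v x \<in> cone_set C}"
      using obj[OF x] x cf by auto
  next
    fix p assume "p \<in> {c \<bullet> x |x. b - A *v x \<in> cone_set C}"
    then obtain x where x: "p = c \<bullet> x" "conic_feasible C (D \<theta>) x (b - A *v x)"
      using cf by auto
    then have "sos_feasible P \<theta> (\<omega> x) (\<nu> x)" "p = sos_objective P \<theta> (\<omega> x)"
      using feas obj by auto
    then show "p \<in> {sos_objective P \<theta> W |W V. sos_feasible P \<theta> W V}"
      by blast
  qed
  then show ?thesis
    by (simp add: sos_value_def optimal_value_def D)
qed

theorem lemma3:
  fixes P :: "('n::finite, 'm::finite, 'p::finite) split_problem"
    and C :: "('k::finite, 'r::finite) sdp_cone"
    and D :: "(real^'p) \<Rightarrow> ('k, 'l::finite) conic_data"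
    and \<theta> :: "(real^'p)"
  assumes "well_posed P"
    and "\<theta> \<in> admissible P"
    and "conic_form P C D"
    and "\<forall>\<theta>'\<in>admissible P. D differentiable (at \<theta>')"
    and A1: "ball_constraints P \<theta>"
    and A2: "transversal P \<theta>"
    and A3: "\<exists>x y s. pd_solution C (D \<theta>) x y s \<and> strictly_complementary C y s \<and>
           (\<forall>x' y' s'. pd_solution C (D \<theta>) x' y' s' \<longrightarrow> x' = x \<and> y' = y \<and> s' = s)"
  shows "sos_value P differentiable (at \<theta>)"
proof -
  obtain x y where kkt: "kkt_point (cone_set C) (D \<theta>) (x, y)"
    and uniq: "\<And>z. kkt_point (cone_set C) (D \<theta>) z \<Longrightarrow> z = (x, y)"
    using A3 unfolding pd_solution_iff_kkt_point by (metis prod.exhaust)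
  obtain D' where D': "(D has_derivative D') (at \<theta>)"
    using assms(2,4) unfolding differentiable_def by blast
  have "(optimal_value (cone_set C) has_derivative lagrangian (x, y)) (at (D \<theta>))"
    by (rule optimal_value_has_derivative[OF cone_set_closed cone_set_convex cone_set_cone
          zero_in_cone_set kkt uniq])
  from diff_chain_at[OF D' this]
  have "((\<lambda>\<theta>. optimal_value (cone_set C) (D \<theta>)) has_derivative lagrangian (x, y) \<circ> D') (at \<theta>)"
    by (simp add: o_def)
  then have "(sos_value P has_derivative lagrangian (x, y) \<circ> D') (at \<theta>)"
    by (rule has_derivative_transform_within_open[OF _ open_admissible assms(2)])
      (simp add: sos_value_eq_optimal_value[OF assms(3)])
  then show ?thesis
    unfolding differentiable_def by blast
qed

end
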